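(* Let $X$ be a Tychonoff space and let $E\subseteq c_0$ be a non-zero symmetric sequence ideal. If there exists a continuous linear surjection $T:C_p(X)\to E_p$, then $E=c_0$.
   Context: All vector spaces are real; sequences are indexed by $\mathbb{N}=\{1,2,\dots\}$. $c_0$ is the space of real sequences converging to $0$. For a Tychonoff (completely regular Hausdorff) space $X$, $C_p(X)$ is the vector space $C(X)$ of all continuous real-valued functions on $X$ with the topology of pointwise convergence. For $x=(x_n)\in c_0$ the decreasing rearrangement $x^*=(x_n^* )$ is defined by $x_n^*=\inf_{F\subseteq\mathbb{N},\,|F|<n}\ \sup_{k\notin F}|x_k|$ for $n\in\mathbb{N}$. A linear subspace $E\subseteq c_0$ is called a symmetric sequence ideal if whenever $x\in E$, $y\in c_0$ and $y_n^*\le x_n^*$ for every $n$, then $y\in E$. For a linear subspace $E$ of $\mathbb{R}^{\mathbb{N}}$, $E_p$ denotes $E$ with the subspace topology inherited from the product space $\mathbb{R}^{\mathbb{N}}$. *)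

theory Defs
  imports "HOL-Analysis.Analysis" "HOL-Library.Function_Algebras"
begin

definition Tychonoff_space :: "'a topology \<Rightarrow> bool" where
  "Tychonoff_space X \<longleftrightarrow> completely_regular_space X \<and> Hausdorff_space X"

(* As usual for product_topology, a function on the points of X is represented by its
   extensional representative, so the topspace of Cp X is
   {f \<in> extensional (topspace X). continuous_map X euclideanreal f}. *)
definition Cp :: "'a topology \<Rightarrow> ('a \<Rightarrow> real) topology" where
  "Cp X = subtopology (product_topology (\<lambda>_. euclideanreal) (topspace X))
            {f. continuous_map X euclideanreal f}"

(* Real sequences (x_1, x_2, ...) have type nat => real, with x_n stored as x (n - 1). *)

interpretation seq: vector_space "\<lambda>(c::real) (x::nat \<Rightarrow> real) n. c * x n"
  by unfold_locales (auto simp: fun_eq_iff algebra_simps)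

definition c0 :: "(nat \<Rightarrow> real) set" where
  "c0 = {x. x \<longlonglongrightarrow> 0}"

(* Because of the index shift, the bound |F| < n becomes card F < n + 1 here. For x in c0
   all the suprema are over bounded non-empty sets and the infimum is over a non-empty set
   that is bounded below, so the real-valued SUP and INF are the intended ones. *)
definition decreasing_rearrangement :: "(nat \<Rightarrow> real) \<Rightarrow> nat \<Rightarrow> real" where
  "decreasing_rearrangement x n =
     (INF F\<in>{F. finite F \<and> card F < n + 1}. SUP k\<in>- F. \<bar>x k\<bar>)"

definition symmetric_sequence_ideal :: "(nat \<Rightarrow> real) set \<Rightarrow> bool" where
  "symmetric_sequence_ideal E \<longleftrightarrow>
     E \<subseteq> c0 \<and> seq.subspace E \<and>
     (\<forall>x\<in>E. \<forall>y\<in>c0.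
        (\<forall>n. decreasing_rearrangement y n \<le> decreasing_rearrangement x n) \<longrightarrow> y \<in> E)"

definition pointwise_topology :: "(nat \<Rightarrow> real) set \<Rightarrow> (nat \<Rightarrow> real) topology" where
  "pointwise_topology E = subtopology (product_topology (\<lambda>_. euclideanreal) UNIV) E"

(* The vector space operations of C(X) are restricted to topspace X in order to
   stay within the extensional functions. *)
definition linear_on_Cp :: "'a topology \<Rightarrow> (('a \<Rightarrow> real) \<Rightarrow> (nat \<Rightarrow> real)) \<Rightarrow> bool" where
  "linear_on_Cp X T \<longleftrightarrow>
     (\<forall>f\<in>topspace (Cp X). \<forall>g\<in>topspace (Cp X).
        T (\<lambda>x\<in>topspace X. f x + g x) = (\<lambda>n. T f n + T g n)) \<and>
     (\<forall>c. \<forall>f\<in>topspace (Cp X).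
        T (\<lambda>x\<in>topspace X. c * f x) = (\<lambda>n. c * T f n))"

definition continuous_linear_surjection ::
    "'a topology \<Rightarrow> (nat \<Rightarrow> real) set \<Rightarrow> (('a \<Rightarrow> real) \<Rightarrow> (nat \<Rightarrow> real)) \<Rightarrow> bool" where
  "continuous_linear_surjection X E T \<longleftrightarrow>
     continuous_map (Cp X) (pointwise_topology E) T \<and>
     linear_on_Cp X T \<and>
     T ` topspace (Cp X) = E"

end

theory Submission
  imports Defs
begin

text \<open>
  Every coordinate of a continuous linear map \<open>T\<close> on \<open>C\<^sub>p(X)\<close> is a finite linear combination of
  evaluations, so \<open>T\<close> is given by a sequence of finitely supported signed measures \<open>\<mu>\<^sub>n\<close> on \<open>X\<close>
  with \<open>\<integral>f d\<mu>\<^sub>n \<rightarrow> 0\<close> for every continuous \<open>f\<close>. Since \<open>E\<close> is symmetric, only the number of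
  coordinates above each level matters: it suffices to find, for any prescribed counts, a continuous
  \<open>f\<close> for which enough of the integrals \<open>\<integral>f d\<mu>\<^sub>j\<close> exceed the levels \<open>a q\<^sup>k\<close>,
  where \<open>a\<close> and \<open>q\<close> are independent of the counts.

  The tool is a gliding hump without any bookkeeping of supports. Of the two numbers
  \<open>u + v\<close> and \<open>u - v\<close> one is at least \<open>\<bar>v\<bar>\<close> in modulus. Adding the functions \<open>q\<^sup>k h\<^sub>k\<close>
  one after the other with suitable signs therefore makes at least half of the integrals in the
  \<open>k\<close>-th finite block large, and the tail of the geometric series is too small to undo this
  (\<open>signed_geometric_series\<close>). It is used three times.

  \<^item> With blocks of size one and norming functions \<open>h\<^sub>k\<close> for the measures \<open>w \<mu>\<^sub>n\<close>, it
    proves a uniform boundedness principle: \<open>\<integral>\<bar>w\<bar> d\<bar>\<mu>\<^sub>n\<bar>\<close> is bounded in \<open>n\<close> for each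
    continuous \<open>w\<close>. Taking \<open>w = f\<^sup>2\<close>, the Cauchy-Schwarz inequality gives
    \<open>\<bar>\<integral>f d\<mu>\<^sub>n\<bar> \<le> C \<parallel>\<mu>\<^sub>n\<parallel>\<^sup>1\<^sup>/\<^sup>2\<close>, also for unbounded \<open>f\<close>.
  \<^item> With blocks of size one again, it yields an element of \<open>E\<close> with no zero coordinate. If
    \<open>\<parallel>\<mu>\<^sub>n\<parallel>\<close> tended to zero, symmetry would allow its coordinates to be moved to sparse
    positions where \<open>\<parallel>\<mu>\<^sub>n\<parallel>\<close> is much smaller, contradicting the previous inequality. Here
    surjectivity of \<open>T\<close> is essential.
  \<^item> So \<open>\<parallel>\<mu>\<^sub>n\<parallel>\<close> does not tend to zero, and then a fixed amount of mass escapes from every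
    finite set (\<open>escape_of_mass\<close>), because such a null sequence of measures cannot concentrate on
    finite sets. Hence for each \<open>N\<close> there is a continuous \<open>h\<close> with values in \<open>[-1, 1]\<close> and
    \<open>N\<close> integrals above a constant that does not depend on \<open>N\<close> (\<open>many_large_integrals\<close>).
    With these \<open>h\<close> and large blocks the series produces the required \<open>f\<close>.
\<close>

section \<open>Continuous functions with prescribed values at finitely many points\<close>

lemma Tychonoff_separate_point:
  fixes X :: "'a topology"
  assumes "Tychonoff_space X" "finite A" "A \<subseteq> topspace X" "x \<in> topspace X"
  obtains u :: "'a \<Rightarrow> real" where "continuous_map X euclideanreal u"
    "\<And>y. y \<in> topspace X \<Longrightarrow> \<bar>u y\<bar> \<le> 1" "u x = 1" "\<And>y. y \<in> A - {x} \<Longrightarrow> u y = 0"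
proof -
  have H: "Hausdorff_space X" and C: "completely_regular_space X"
    using assms(1) by (auto simp: Tychonoff_space_def)
  have "closedin X (A - {x})"
    using closedin_Hausdorff_finite[OF H, of "A - {x}"] assms by auto
  then obtain f :: "'a \<Rightarrow> real" where f: "continuous_map X (top_of_set {0..1}) f"
      "f x = 0" "f ` (A - {x}) \<subseteq> {1}"
    using C assms(4) unfolding completely_regular_space_def by (metis DiffD2 DiffI insertI1)
  have fc: "continuous_map X euclideanreal f" and f01: "\<And>y. y \<in> topspace X \<Longrightarrow> f y \<in> {0..1}"
    using f(1) by (auto simp: continuous_map_in_subtopology)
  show thesis
  proof
    show "continuous_map X euclideanreal (\<lambda>y. 1 - f y)"
      by (intro continuous_intros fc)
    show "\<bar>1 - f y\<bar> \<le> 1" if "y \<in> topspace X" for y using f01[OF that] by auto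
  qed (use f in auto)
qed

lemma Tychonoff_interpolation:
  fixes X :: "'a topology" and s :: "'a \<Rightarrow> real"
  assumes "Tychonoff_space X" "finite A" "A \<subseteq> topspace X" "\<And>x. x \<in> A \<Longrightarrow> \<bar>s x\<bar> \<le> 1"
  obtains h where "continuous_map X euclideanreal h"
    "\<And>y. y \<in> topspace X \<Longrightarrow> \<bar>h y\<bar> \<le> 1" "\<And>x. x \<in> A \<Longrightarrow> h x = s x"
proof -
  have "\<exists>u. continuous_map X euclideanreal u \<and> u x = 1 \<and> (\<forall>y\<in>A - {x}. u y = 0)" if "x \<in> A" for x
    using Tychonoff_separate_point[OF assms(1-3), of x] that assms(3) by (metis subsetD)
  then obtain u where u: "\<And>x. x \<in> A \<Longrightarrow> continuous_map X euclideanreal (u x)"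
      "\<And>x. x \<in> A \<Longrightarrow> u x x = 1" "\<And>x y. x \<in> A \<Longrightarrow> y \<in> A - {x} \<Longrightarrow> u x y = 0"
    by metis
  define g where "g = (\<lambda>y. \<Sum>x\<in>A. s x * u x y)"
  have gc: "continuous_map X euclideanreal g"
    unfolding g_def by (intro continuous_intros continuous_map_sum u assms)
  have gs: "g y = s y" if "y \<in> A" for y
  proof -
    have "g y = (\<Sum>x\<in>A. if x = y then s x else 0)"
      unfolding g_def by (rule sum.cong) (use u that in auto)
    then show ?thesis using that assms(2) by simp
  qed
  show thesis
  proof
    show "continuous_map X euclideanreal (\<lambda>y. max (-1) (min 1 (g y)))"
      by (intro continuous_map_real_max continuous_map_real_min continuous_intros gc)
    show "max (-1) (min 1 (g x)) = s x" if "x \<in> A" for x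
      using gs[OF that] assms(4)[OF that] by auto
  qed auto
qed

section \<open>Continuous linear functionals on spaces of pointwise convergence\<close>

lemma Cp_topspace: "topspace (Cp X) = {f \<in> extensional (topspace X). continuous_map X euclideanreal f}"
  by (auto simp: Cp_def PiE_def)

lemma restrict_in_Cp:
  "continuous_map X euclideanreal f \<Longrightarrow> restrict f (topspace X) \<in> topspace (Cp X)"
  unfolding Cp_topspace by (auto elim!: continuous_map_eq)

text \<open>
  A neighbourhood of zero on which the functional is less than \<open>1\<close> restricts only the values on a
  finite set \<open>F\<close>. By homogeneity the functional vanishes on all functions that vanish on \<open>F\<close>, so
  it depends only on the values on \<open>F\<close>; its coefficients are its values at functions that
  restrict to the unit vectors on \<open>F\<close>.
\<close>

lemma Cp_functional_finite_support:
  fixes X :: "'a topology" and \<phi> :: "('a \<Rightarrow> real) \<Rightarrow> real"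
  assumes X: "Tychonoff_space X"
    and cont: "continuous_map (Cp X) euclideanreal \<phi>"
    and add: "\<And>f g. f \<in> topspace (Cp X) \<Longrightarrow> g \<in> topspace (Cp X) \<Longrightarrow>
                \<phi> (\<lambda>x\<in>topspace X. f x + g x) = \<phi> f + \<phi> g"
    and scale: "\<And>c f. f \<in> topspace (Cp X) \<Longrightarrow> \<phi> (\<lambda>x\<in>topspace X. c * f x) = c * \<phi> f"
  obtains F \<mu> where "finite F" "F \<subseteq> topspace X"
    "\<And>f. continuous_map X euclideanreal f \<Longrightarrow> \<phi> (restrict f (topspace X)) = (\<Sum>x\<in>F. \<mu> x * f x)"
proof -
  let ?S = "topspace X"
  \<comment> \<open>Passing to \<open>\<psi>\<close> allows ordinary pointwise operations in place of extensional ones.\<close>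
  define \<psi> where "\<psi> f = \<phi> (restrict f ?S)" for f
  have \<psi>_add: "\<psi> (\<lambda>x. f x + g x) = \<psi> f + \<psi> g"
    if "continuous_map X euclideanreal f" "continuous_map X euclideanreal g" for f g
  proof -
    have "(\<lambda>x\<in>?S. restrict f ?S x + restrict g ?S x) = restrict (\<lambda>x. f x + g x) ?S"
      by auto
    with add[OF restrict_in_Cp[OF that(1)] restrict_in_Cp[OF that(2)]] show ?thesis
      by (simp add: \<psi>_def)
  qed
  have \<psi>_scale: "\<psi> (\<lambda>x. c * f x) = c * \<psi> f" if "continuous_map X euclideanreal f" for f c
  proof -
    have "(\<lambda>x\<in>?S. c * restrict f ?S x) = restrict (\<lambda>x. c * f x) ?S"
      by auto
    with scale[OF restrict_in_Cp[OF that], of c] show ?thesis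
      by (simp add: \<psi>_def)
  qed
  have \<psi>_0: "\<psi> (\<lambda>x. 0) = 0"
    using \<psi>_scale[of "\<lambda>x. 0" 0] by simp
  have \<psi>_sum: "\<psi> (\<lambda>x. \<Sum>i\<in>A. c i * g i x) = (\<Sum>i\<in>A. c i * \<psi> (g i))"
    if "finite A" "\<And>i. i \<in> A \<Longrightarrow> continuous_map X euclideanreal (g i)" for A c and g :: "'a \<Rightarrow> 'a \<Rightarrow> real"
    using that
  proof (induction A)
    case empty
    show ?case by (simp add: \<psi>_0)
  next
    case (insert i A)
    have "\<psi> (\<lambda>x. c i * g i x + (\<Sum>i\<in>A. c i * g i x)) = \<psi> (\<lambda>x. c i * g i x) + \<psi> (\<lambda>x. \<Sum>i\<in>A. c i * g i x)"
      using insert by (intro \<psi>_add continuous_intros continuous_map_sum) auto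
    with insert show ?case by (simp add: \<psi>_scale)
  qed
  let ?z = "restrict (\<lambda>x. 0::real) ?S"
  have zC: "?z \<in> topspace (Cp X)" by (rule restrict_in_Cp) simp
  have "openin (Cp X) {f \<in> topspace (Cp X). \<phi> f \<in> {-1<..<1}}"
    using openin_continuous_map_preimage[OF cont, of "{-1<..<1}"] by auto
  then obtain U where U: "openin (product_topology (\<lambda>_. euclideanreal) ?S) U"
      "{f \<in> topspace (Cp X). \<phi> f \<in> {-1<..<1}} = U \<inter> {f. continuous_map X euclideanreal f}"
    unfolding Cp_def openin_subtopology by blast
  have "?z \<in> {f \<in> topspace (Cp X). \<phi> f \<in> {-1<..<1}}"
    using zC \<psi>_0 by (simp add: \<psi>_def)
  then have "?z \<in> U" unfolding U(2) by blast
  then obtain V where V: "finite {i \<in> ?S. V i \<noteq> UNIV}" "?z \<in> PiE ?S V" "PiE ?S V \<subseteq> U"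
    using U(1) unfolding openin_product_topology_alt by auto
  define F where "F = {i \<in> ?S. V i \<noteq> UNIV}"
  have F: "finite F" "F \<subseteq> ?S" using V(1) by (auto simp: F_def)
  have small: "\<bar>\<psi> f\<bar> < 1" if f: "continuous_map X euclideanreal f" "\<And>x. x \<in> F \<Longrightarrow> f x = 0" for f
  proof -
    have "restrict f ?S \<in> PiE ?S V"
    proof (rule restrict_PiE_iff[THEN iffD2], rule ballI)
      fix i assume i: "i \<in> ?S"
      show "f i \<in> V i"
      proof (cases "i \<in> F")
        case True
        with f(2) V(2) i show ?thesis by (auto simp: PiE_iff)
      next
        case False
        with i show ?thesis by (auto simp: F_def)
      qed
    qed
    moreover have "continuous_map X euclideanreal (restrict f ?S)"
      using restrict_in_Cp[OF f(1)] by (simp add: Cp_topspace)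
    ultimately have "restrict f ?S \<in> U \<inter> {f. continuous_map X euclideanreal f}"
      using V(3) by blast
    then show ?thesis unfolding U(2)[symmetric] by (simp add: \<psi>_def abs_less_iff)
  qed
  have vanish: "\<psi> f = 0" if f: "continuous_map X euclideanreal f" "\<And>x. x \<in> F \<Longrightarrow> f x = 0" for f
  proof (rule ccontr)
    assume nz: "\<psi> f \<noteq> 0"
    have "\<bar>\<psi> (\<lambda>x. (1 / \<psi> f) * f x)\<bar> < 1"
      using f by (intro small continuous_intros) auto
    with nz show False using f(1) by (simp only: \<psi>_scale) simp
  qed
  have "\<exists>u. continuous_map X euclideanreal u \<and> u x = 1 \<and> (\<forall>y\<in>F - {x}. u y = 0)" if "x \<in> F" for x
    using Tychonoff_separate_point[OF X F, of x] that F(2) by (metis subsetD)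
  then obtain u where u: "\<And>x. x \<in> F \<Longrightarrow> continuous_map X euclideanreal (u x)"
      "\<And>x. x \<in> F \<Longrightarrow> u x x = 1" "\<And>x y. x \<in> F \<Longrightarrow> y \<in> F - {x} \<Longrightarrow> u x y = 0"
    by metis
  have "\<psi> f = (\<Sum>x\<in>F. \<psi> (u x) * f x)" if f: "continuous_map X euclideanreal f" for f
  proof -
    let ?g = "\<lambda>y. \<Sum>x\<in>F. f x * u x y"
    have gc: "continuous_map X euclideanreal ?g"
      by (intro continuous_intros continuous_map_sum u F)
    have "?g y = f y" if "y \<in> F" for y
    proof -
      have "?g y = (\<Sum>x\<in>F. if x = y then f x else 0)"
        by (rule sum.cong) (use u that in auto)
      then show ?thesis using that F(1) by simp
    qed
    then have "\<psi> (\<lambda>y. f y + (-1) * ?g y) = 0"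
      by (intro vanish continuous_map_add[OF f] continuous_map_real_mult_left gc) auto
    moreover have "\<psi> (\<lambda>y. f y + (-1) * ?g y) = \<psi> f + \<psi> (\<lambda>y. (-1) * ?g y)"
      by (intro \<psi>_add continuous_intros f gc)
    moreover have "\<psi> (\<lambda>y. (-1) * ?g y) = (-1) * \<psi> ?g"
      by (rule \<psi>_scale[OF gc])
    ultimately have "\<psi> f = \<psi> ?g" by simp
    also have "\<dots> = (\<Sum>x\<in>F. f x * \<psi> (u x))"
      by (rule \<psi>_sum[OF F(1) u(1)])
    finally show ?thesis by (simp add: mult.commute)
  qed
  with F that[of F "\<lambda>x. \<psi> (u x)"] show thesis by (simp add: \<psi>_def)
qed

section \<open>Symmetric sequence ideals\<close>

lemma c0_finite_superlevel:
  assumes "x \<in> c0" "0 < t"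
  shows "finite {j. t \<le> \<bar>x j\<bar>}"
proof -
  from assms have "\<forall>\<^sub>F n in sequentially. \<bar>x n\<bar> < t"
    using tendstoD[of x 0 sequentially t] by (auto simp: c0_def dist_real_def)
  then obtain N where "\<And>n. n \<ge> N \<Longrightarrow> \<bar>x n\<bar> < t"
    by (auto simp: eventually_sequentially)
  then have "{j. t \<le> \<bar>x j\<bar>} \<subseteq> {..<N}" by (auto simp: not_le[symmetric]) 
  then show ?thesis by (rule finite_subset) simp
qed

lemma c0_bounded:
  assumes "x \<in> c0"
  obtains B where "0 < B" "\<And>j. \<bar>x j\<bar> \<le> B"
proof -
  have "Bseq x" using assms by (auto simp: c0_def intro: convergent_imp_Bseq convergentI)
  then show thesis using that by (auto simp: Bseq_def)
qed

text \<open>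
  The \<open>n\<close>-th term of the decreasing rearrangement exceeds \<open>t\<close> only if more than \<open>n\<close> coordinates are
  at least \<open>t\<close> in modulus, and it is at least \<open>t\<close> whenever this is so. Comparing level counts avoids
  computing infima and suprema in all later uses of symmetry.
\<close>

lemma decreasing_rearrangement_mono:
  assumes x: "x \<in> c0" and y: "y \<in> c0"
    and card: "\<And>t. 0 < t \<Longrightarrow> card {j. t \<le> \<bar>y j\<bar>} \<le> card {j. t \<le> \<bar>x j\<bar>}"
  shows "decreasing_rearrangement y n \<le> decreasing_rearrangement x n"
proof (rule field_le_epsilon, rule ccontr)
  fix e :: real assume "0 < e"
  let ?D = "decreasing_rearrangement" and ?\<F> = "{F::nat set. finite F \<and> card F < n + 1}"
  have bdd: "bdd_above ((\<lambda>k. \<bar>z k\<bar>) ` S)" if "z \<in> c0" for z S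
    using c0_bounded[OF that] by (metis bdd_above.I2)
  have ne: "- F \<noteq> {}" if "F \<in> ?\<F>" for F
    using that infinite_UNIV_nat by (metis (mono_tags, lifting) Compl_empty_eq double_complement mem_Collect_eq)
  have sup_ge: "\<bar>z k\<bar> \<le> (SUP k\<in>-F. \<bar>z k\<bar>)" if "z \<in> c0" "k \<notin> F" for z k F
    using that by (intro cSUP_upper bdd) auto
  have sup0: "0 \<le> (SUP k\<in>-F. \<bar>z k\<bar>)" if "z \<in> c0" "F \<in> ?\<F>" for z F
    using ne[OF that(2)] sup_ge[OF that(1), of _ F] by (meson ComplD abs_ge_zero all_not_in_conv order_trans)
  have \<F>ne: "?\<F> \<noteq> {}" by (auto intro: exI[of _ "{}"])
  have Dx0: "0 \<le> ?D x n"
    unfolding decreasing_rearrangement_def by (rule cINF_greatest[OF \<F>ne]) (rule sup0[OF x])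
  assume "\<not> ?D y n \<le> ?D x n + e"
  then have lt: "?D x n + e < ?D y n" by simp
  define t where "t = ?D x n + e"
  have t: "0 < t" using Dx0 \<open>0 < e\<close> by (simp add: t_def)
  have "n + 1 \<le> card {j. t \<le> \<bar>y j\<bar>}"
  proof (rule ccontr)
    assume "\<not> n + 1 \<le> card {j. t \<le> \<bar>y j\<bar>}"
    with c0_finite_superlevel[OF y t] have F: "{j. t \<le> \<bar>y j\<bar>} \<in> ?\<F>" by simp
    have "?D y n \<le> (SUP k\<in>-{j. t \<le> \<bar>y j\<bar>}. \<bar>y k\<bar>)"
      unfolding decreasing_rearrangement_def
      by (rule cINF_lower[OF _ F]) (rule bdd_belowI2[of _ 0], rule sup0[OF y])
    also have "\<dots> \<le> t"
      using ne[OF F] by (intro cSUP_least) auto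
    finally show False using lt by (simp add: t_def)
  qed
  with card[OF t] have big: "n + 1 \<le> card {j. t \<le> \<bar>x j\<bar>}" by simp
  have "t \<le> ?D x n"
    unfolding decreasing_rearrangement_def
  proof (rule cINF_greatest[OF \<F>ne])
    fix F assume F: "F \<in> ?\<F>"
    have "\<not> {j. t \<le> \<bar>x j\<bar>} \<subseteq> F"
      using big F card_mono[of F "{j. t \<le> \<bar>x j\<bar>}"] by auto
    then obtain j where "t \<le> \<bar>x j\<bar>" "j \<notin> F" by auto
    then show "t \<le> (SUP k\<in>-F. \<bar>x k\<bar>)" using sup_ge[OF x, of j F] by simp
  qed
  then show False using \<open>0 < e\<close> by (simp add: t_def)
qed

lemma symmetric_sequence_ideal_card:
  assumes "symmetric_sequence_ideal E" "x \<in> E" "y \<in> c0"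
    and "\<And>t. 0 < t \<Longrightarrow> card {j. t \<le> \<bar>y j\<bar>} \<le> card {j. t \<le> \<bar>x j\<bar>}"
  shows "y \<in> E"
  using assms decreasing_rearrangement_mono[of x y] unfolding symmetric_sequence_ideal_def by blast

lemma symmetric_sequence_ideal_unit:
  assumes E: "symmetric_sequence_ideal E" "E \<noteq> {\<lambda>n. 0}"
  obtains a where "a \<noteq> 0" "\<And>n. (\<lambda>k. if k = n then a else 0) \<in> E"
proof -
  have "0 \<in> E" using E(1) unfolding symmetric_sequence_ideal_def by (auto dest: seq.subspace_0)
  then have "(\<lambda>n. 0) \<in> E" by (simp add: zero_fun_def)
  with E(2) obtain x where x: "x \<in> E" "x \<noteq> (\<lambda>n. 0)" by blast
  then obtain i where i: "x i \<noteq> 0" by auto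
  have xc: "x \<in> c0" using x E unfolding symmetric_sequence_ideal_def by auto
  have "(\<lambda>k. if k = n then x i else 0) \<in> E" for n
  proof (rule symmetric_sequence_ideal_card[OF E(1) x(1)])
    show "(\<lambda>k. if k = n then x i else 0) \<in> c0"
      unfolding c0_def mem_Collect_eq
      by (rule tendsto_eventually, rule eventually_mono[OF eventually_gt_at_top[of n]]) auto
    fix t :: real assume t: "0 < t"
    show "card {j. t \<le> \<bar>if j = n then x i else 0\<bar>} \<le> card {j. t \<le> \<bar>x j\<bar>}"
    proof (cases "t \<le> \<bar>x i\<bar>")
      case True
      have "{j. t \<le> \<bar>if j = n then x i else 0\<bar>} = {n}" using True t by auto
      moreover have "card {i} \<le> card {j. t \<le> \<bar>x j\<bar>}"
        using True by (intro card_mono c0_finite_superlevel[OF xc t]) auto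
      ultimately show ?thesis by simp
    next
      case False
      then have "{j. t \<le> \<bar>if j = n then x i else 0\<bar>} = {}" using t by auto
      then show ?thesis by (simp only: card.empty)
    qed
  qed
  with i that show thesis by blast
qed

lemma symmetric_sequence_ideal_relocate:
  assumes E: "symmetric_sequence_ideal E" "x \<in> E" and p: "strict_mono (p :: nat \<Rightarrow> nat)"
  obtains y where "y \<in> E" "\<And>k. y (p k) = x k"
proof -
  have inj: "inj p" using p by (rule strict_mono_imp_inj_on)
  have xc: "x \<in> c0" using E unfolding symmetric_sequence_ideal_def by auto
  define y where "y = (\<lambda>j. if j \<in> range p then x (inv p j) else 0)"
  have yp: "y (p k) = x k" for k by (simp add: y_def inj)
  have level: "{j. t \<le> \<bar>y j\<bar>} = p ` {k. t \<le> \<bar>x k\<bar>}" if "0 < t" for t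
    using that by (auto simp: y_def inj_eq[OF inj] inv_f_f[OF inj] split: if_splits)
  have "y \<in> c0"
    unfolding c0_def
  proof (rule CollectI, rule LIMSEQ_I)
    fix t :: real assume t: "0 < t"
    have "finite {j. t \<le> \<bar>y j\<bar>}" using level[OF t] c0_finite_superlevel[OF xc t] by simp
    then obtain N where "\<forall>j\<in>{j. t \<le> \<bar>y j\<bar>}. j < N" by (auto simp: finite_nat_set_iff_bounded)
    then show "\<exists>N. \<forall>n\<ge>N. norm (y n - 0) < t" by (intro exI[of _ N]) (auto simp: not_le[symmetric])
  qed
  then have "y \<in> E"
    using level by (intro symmetric_sequence_ideal_card[OF E]) (auto simp: card_image inj_on_subset[OF inj])
  with yp that show thesis by blast
qed

section \<open>Signed geometric series\<close>

text \<open>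
  For each \<open>j\<close> one of the two signs works, so one of the signs works for at least half of the \<open>j\<close>.
\<close>

lemma sign_choice:
  fixes a b :: "'b \<Rightarrow> real"
  assumes "finite J"
  shows "\<exists>\<sigma>. \<bar>\<sigma>\<bar> = 1 \<and> card J \<le> 2 * card {j \<in> J. \<bar>b j\<bar> \<le> \<bar>a j + \<sigma> * b j\<bar>}"
proof (rule ccontr)
  assume neg: "\<not> ?thesis"
  let ?P = "\<lambda>\<sigma>. {j \<in> J. \<bar>b j\<bar> \<le> \<bar>a j + \<sigma> * b j\<bar>}"
  have "2 * card (?P \<sigma>) < card J" if "\<bar>\<sigma>\<bar> = 1" for \<sigma>
    using neg that by (meson not_le)
  from this[of 1] this[of "-1"] have "2 * card (?P 1) < card J" "2 * card (?P (-1)) < card J"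
    by simp_all
  moreover have "J \<subseteq> ?P 1 \<union> ?P (-1)" by auto
  then have "card J \<le> card (?P 1 \<union> ?P (-1))"
    using assms by (intro card_mono) auto
  ultimately show False using card_Un_le[of "?P 1" "?P (-1)"] by simp
qed

lemma bounded_geometric_series:
  fixes g :: "nat \<Rightarrow> 'a \<Rightarrow> real"
  assumes g: "\<And>k. continuous_map X euclideanreal (g k)"
      "\<And>k x. x \<in> topspace X \<Longrightarrow> \<bar>g k x\<bar> \<le> q ^ k"
    and q: "0 < q" "q < 1"
  obtains f where "continuous_map X euclideanreal f"
    "\<And>k x. x \<in> topspace X \<Longrightarrow> \<bar>f x - (\<Sum>i<k. g i x)\<bar> \<le> q ^ k / (1 - q)"
proof -
  define f where "f x = (\<Sum>k. g k x)" for x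
  have tail: "\<bar>f x - (\<Sum>i<k. g i x)\<bar> \<le> q ^ k / (1 - q)" if x: "x \<in> topspace X" for x k
  proof -
    have sm: "summable (\<lambda>k. g k x)"
      by (rule summable_comparison_test'[where g = "\<lambda>k. q ^ k" and N = 0])
        (use q g(2)[OF x] in \<open>auto intro: summable_geometric\<close>)
    have sums: "(\<lambda>i. q ^ (i + k)) sums (q ^ k / (1 - q))"
      using sums_mult[OF geometric_sums[of q], of "q ^ k"] q by (simp add: power_add mult.commute)
    have "f x - (\<Sum>i<k. g i x) = (\<Sum>i. g (i + k) x)"
      unfolding f_def by (rule suminf_minus_initial_segment[OF sm, symmetric])
    moreover have "norm (\<Sum>i. g (i + k) x) \<le> (\<Sum>i. q ^ (i + k))"
      by (rule norm_suminf_le) (use g(2)[OF x] sums in \<open>auto simp: sums_iff\<close>)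
    ultimately show ?thesis using sums by (simp add: sums_iff)
  qed
  have lim0: "(\<lambda>k. q ^ k / (1 - q)) \<longlonglongrightarrow> 0"
    using q by (intro tendsto_divide_zero LIMSEQ_power_zero) auto
  have "continuous_map X Met_TC.mtopology f"
  proof (rule Met_TC.continuous_map_uniform_limit)
    show "\<forall>\<^sub>F k in sequentially. continuous_map X Met_TC.mtopology (\<lambda>x. \<Sum>i<k. g i x)"
      by (auto intro!: always_eventually continuous_map_sum g)
    fix e :: real assume "0 < e"
    then have "\<forall>\<^sub>F k in sequentially. q ^ k / (1 - q) < e"
      using lim0 by (rule order_tendstoD(2)[rotated])
    then show "\<forall>\<^sub>F k in sequentially. \<forall>x\<in>topspace X. f x \<in> UNIV \<and> dist (\<Sum>i<k. g i x) (f x) < e"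
      using tail by (auto elim!: eventually_mono simp: dist_real_def abs_minus_commute intro: le_less_trans)
  qed simp
  then have "continuous_map X euclideanreal f" by simp
  with tail that show thesis by blast
qed

text \<open>
  The measure \<open>\<mu>\<^sub>n\<close> has mass \<open>\<mu> n x\<close> at \<open>x \<in> F n\<close>. The set \<open>F n\<close> need only contain the support,
  so the same sets serve for the measures with density \<open>w\<close> with respect to \<open>\<mu>\<^sub>n\<close>.
\<close>

locale finitely_supported_measures =
  fixes X :: "'a topology" and F :: "nat \<Rightarrow> 'a set" and \<mu> :: "nat \<Rightarrow> 'a \<Rightarrow> real"
  assumes Tychonoff: "Tychonoff_space X"
    and finite_support: "finite (F n)"
    and support_subset: "F n \<subseteq> topspace X"
begin

definition integral_against :: "nat \<Rightarrow> ('a \<Rightarrow> real) \<Rightarrow> real" where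
  "integral_against n f = (\<Sum>x\<in>F n. \<mu> n x * f x)"

text \<open>The measure \<open>\<bar>\<mu>\<^sub>n\<bar>(A)\<close>.\<close>

definition variation :: "nat \<Rightarrow> 'a set \<Rightarrow> real" where
  "variation n A = (\<Sum>x\<in>F n \<inter> A. \<bar>\<mu> n x\<bar>)"

abbreviation total_variation :: "nat \<Rightarrow> real" where
  "total_variation n \<equiv> variation n UNIV"

lemma variation_nonneg: "0 \<le> variation n A"
  by (simp add: variation_def sum_nonneg)

lemma variation_split: "total_variation n = variation n A + variation n (- A)"
  unfolding variation_def
  by (subst sum.union_disjoint[symmetric]) (auto simp: finite_support intro!: sum.cong)

lemma integral_against_bound:
  assumes "\<And>x. x \<in> topspace X \<Longrightarrow> \<bar>f x\<bar> \<le> b"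
  shows "\<bar>integral_against n f\<bar> \<le> b * total_variation n"
proof -
  have "\<bar>integral_against n f\<bar> \<le> (\<Sum>x\<in>F n. \<bar>\<mu> n x * f x\<bar>)"
    unfolding integral_against_def by (rule sum_abs)
  also have "\<dots> \<le> (\<Sum>x\<in>F n. b * \<bar>\<mu> n x\<bar>)"
  proof (rule sum_mono)
    fix x assume "x \<in> F n"
    then have "\<bar>f x\<bar> \<le> b" using assms support_subset by blast
    then show "\<bar>\<mu> n x * f x\<bar> \<le> b * \<bar>\<mu> n x\<bar>"
      by (simp add: abs_mult mult.commute mult_right_mono)
  qed
  finally show ?thesis by (simp add: variation_def sum_distrib_left)
qed

lemma norming_function:
  obtains h where "continuous_map X euclideanreal h" "\<And>x. x \<in> topspace X \<Longrightarrow> \<bar>h x\<bar> \<le> 1"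
    "integral_against n h = total_variation n"
proof -
  obtain h where h: "continuous_map X euclideanreal h" "\<And>x. x \<in> topspace X \<Longrightarrow> \<bar>h x\<bar> \<le> 1"
      "\<And>x. x \<in> F n \<Longrightarrow> h x = sgn (\<mu> n x)"
    by (rule Tychonoff_interpolation[OF Tychonoff finite_support[of n] support_subset, where s = "\<lambda>x. sgn (\<mu> n x)"])
      (auto simp: abs_sgn_eq)
  then have "integral_against n h = total_variation n"
    by (simp add: integral_against_def variation_def abs_sgn)
  with h that show thesis by blast
qed

text \<open>
  The signs are chosen one after the other. When \<open>h\<^sub>k\<close> is added, \<open>sign_choice\<close> makes
  at least half of the integrals of the block \<open>J\<^sub>k\<close> at least \<open>c q\<^sup>k \<parallel>\<mu>\<^sub>j\<parallel>\<close>. The ratio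
  \<open>q = c / (c + 2)\<close> is the one for which \<open>q / (1 - q) = c / 2\<close>, so that the remaining terms change
  such an integral by at most half of this amount.
\<close>

lemma signed_geometric_series:
  fixes h :: "nat \<Rightarrow> 'a \<Rightarrow> real" and J :: "nat \<Rightarrow> nat set"
  assumes h: "\<And>k. continuous_map X euclideanreal (h k)"
      "\<And>k x. x \<in> topspace X \<Longrightarrow> \<bar>h k x\<bar> \<le> 1"
    and c: "0 < c"
    and J: "\<And>k. finite (J k)"
      "\<And>k j. j \<in> J k \<Longrightarrow> c * total_variation j \<le> \<bar>integral_against j (h k)\<bar>"
  obtains f where "continuous_map X euclideanreal f"
    "\<And>k. card (J k) \<le>
       2 * card {j \<in> J k. c / 2 * (c / (c + 2)) ^ k * total_variation j \<le> \<bar>integral_against j f\<bar>}"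
proof -
  define q where "q = c / (c + 2)"
  have q: "0 < q" "q < 1" using c by (auto simp: q_def)
  let ?I = integral_against
  define good where "good k \<sigma> g = (card (J k) \<le> 2 * card {j \<in> J k. q ^ k * \<bar>?I j (h k)\<bar> \<le>
      \<bar>?I j (\<lambda>x. g x + \<sigma> * q ^ k * h k x)\<bar>})" for k \<sigma> g
  have choice: "\<exists>\<sigma>. \<bar>\<sigma>\<bar> = 1 \<and> good k \<sigma> g" for k g
  proof -
    have "?I j (\<lambda>x. g x + \<sigma> * q ^ k * h k x) = ?I j g + \<sigma> * (q ^ k * ?I j (h k))" for j \<sigma>
      by (simp add: integral_against_def algebra_simps sum.distrib sum_distrib_left)
    then show ?thesis
      using sign_choice[OF J(1)[of k], of "\<lambda>j. q ^ k * ?I j (h k)" "\<lambda>j. ?I j g"] q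
      by (simp add: good_def abs_mult)
  qed
  have "\<exists>S. \<forall>n. (n = 0 \<longrightarrow> S n = (\<lambda>x. 0)) \<and>
      (\<exists>\<sigma>. \<bar>\<sigma>\<bar> = 1 \<and> S (Suc n) = (\<lambda>x. S n x + \<sigma> * q ^ n * h n x) \<and> good n \<sigma> (S n))"
    by (rule dependent_nat_choice) (use choice in blast)+
  then obtain S where S0: "S 0 = (\<lambda>x. 0)" and
      "\<And>n. \<exists>\<sigma>. \<bar>\<sigma>\<bar> = 1 \<and> S (Suc n) = (\<lambda>x. S n x + \<sigma> * q ^ n * h n x) \<and> good n \<sigma> (S n)"
    by blast
  then obtain \<sigma> where \<sigma>: "\<And>n. \<bar>\<sigma> n\<bar> = 1"
      "\<And>n. S (Suc n) = (\<lambda>x. S n x + \<sigma> n * q ^ n * h n x)" "\<And>n. good n (\<sigma> n) (S n)"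
    by metis
  have S: "S n = (\<lambda>x. \<Sum>i<n. \<sigma> i * q ^ i * h i x)" for n
    by (induction n) (simp_all add: S0 \<sigma>(2))
  have terms: "continuous_map X euclideanreal (\<lambda>x. \<sigma> k * q ^ k * h k x)"
      "x \<in> topspace X \<Longrightarrow> \<bar>\<sigma> k * q ^ k * h k x\<bar> \<le> q ^ k" for k x
    using h(2)[of x k] \<sigma>(1)[of k] q
    by (auto simp: abs_mult mult_left_le intro!: continuous_map_real_mult_left h)
  obtain f where f: "continuous_map X euclideanreal f"
      "\<And>k x. x \<in> topspace X \<Longrightarrow> \<bar>f x - (\<Sum>i<k. \<sigma> i * q ^ i * h i x)\<bar> \<le> q ^ k / (1 - q)"
    by (rule bounded_geometric_series[of X "\<lambda>k x. \<sigma> k * q ^ k * h k x", OF terms q]) blast+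
  have ratio: "q ^ Suc k / (1 - q) = c / 2 * q ^ k" for k
    proof -
    have "q / (1 - q) = c / 2" using c by (simp add: q_def field_simps)
    then show ?thesis by (metis mult.commute power_Suc times_divide_eq_right)
  qed
  have "c / 2 * q ^ k * total_variation j \<le> \<bar>?I j f\<bar>"
    if j: "j \<in> J k" "q ^ k * \<bar>?I j (h k)\<bar> \<le> \<bar>?I j (S (Suc k))\<bar>" for j k
  proof -
    have "\<bar>?I j (\<lambda>x. f x - S (Suc k) x)\<bar> \<le> c / 2 * q ^ k * total_variation j"
      unfolding S using f(2)[of _ "Suc k"] unfolding ratio by (rule integral_against_bound)
    moreover have "?I j (\<lambda>x. f x - S (Suc k) x) = ?I j f - ?I j (S (Suc k))"
      by (simp add: integral_against_def algebra_simps sum_subtractf)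
    moreover have "q ^ k * (c * total_variation j) \<le> q ^ k * \<bar>?I j (h k)\<bar>"
      using J(2)[OF j(1)] q by (intro mult_left_mono) auto
    ultimately show ?thesis using j(2) by (simp add: algebra_simps abs_if split: if_splits)
  qed
  then have sub: "{j \<in> J k. q ^ k * \<bar>?I j (h k)\<bar> \<le> \<bar>?I j (S (Suc k))\<bar>} \<subseteq>
      {j \<in> J k. c / 2 * q ^ k * total_variation j \<le> \<bar>?I j f\<bar>}" for k
    by blast
  have "card (J k) \<le> 2 * card {j \<in> J k. c / 2 * q ^ k * total_variation j \<le> \<bar>?I j f\<bar>}" for k
  proof -
    have "card (J k) \<le> 2 * card {j \<in> J k. q ^ k * \<bar>?I j (h k)\<bar> \<le> \<bar>?I j (S (Suc k))\<bar>}"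
      using \<sigma>(3)[of k] unfolding good_def \<sigma>(2) .
    also have "\<dots> \<le> 2 * card {j \<in> J k. c / 2 * q ^ k * total_variation j \<le> \<bar>?I j f\<bar>}"
      using J(1) by (intro mult_left_mono card_mono sub) auto
    finally show ?thesis .
  qed
  with f(1) that show thesis unfolding q_def by blast
qed

text \<open>
  The case of one-element blocks: at least half of a one-element block is the whole block.
\<close>

lemma norming_series:
  fixes p :: "nat \<Rightarrow> nat"
  obtains f where "continuous_map X euclideanreal f"
    "\<And>k. (1/3) ^ k * total_variation (p k) \<le> 2 * \<bar>integral_against (p k) f\<bar>"
proof -
  have "\<exists>h. continuous_map X euclideanreal h \<and> (\<forall>x\<in>topspace X. \<bar>h x\<bar> \<le> 1) \<and>
      integral_against n h = total_variation n" for n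
    by (rule norming_function[of n]) blast
  then obtain h where h: "\<And>n. continuous_map X euclideanreal (h n)"
      "\<And>n x. x \<in> topspace X \<Longrightarrow> \<bar>h n x\<bar> \<le> 1" "\<And>n. integral_against n (h n) = total_variation n"
    by metis
  obtain f where f: "continuous_map X euclideanreal f"
    "\<And>k. card {p k} \<le>
       2 * card {j \<in> {p k}. 1 / 2 * (1 / (1 + 2)) ^ k * total_variation j \<le> \<bar>integral_against j f\<bar>}"
    by (rule signed_geometric_series[of "\<lambda>k. h (p k)" 1 "\<lambda>k. {p k}"])
      (use h variation_nonneg in auto)
  have "1 / 2 * (1 / (1 + 2)) ^ k * total_variation (p k) \<le> \<bar>integral_against (p k) f\<bar>" for k
  proof (rule ccontr)
    assume "\<not> ?thesis"
    then have "{j \<in> {p k}. 1 / 2 * (1 / (1 + 2)) ^ k * total_variation j \<le> \<bar>integral_against j f\<bar>} = {}"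
      by blast
    with f(2)[of k] show False by (simp only: card.empty) simp
  qed
  then have "(1/3) ^ k * total_variation (p k) \<le> 2 * \<bar>integral_against (p k) f\<bar>" for k
    by (simp add: field_simps)
  with f(1) that show thesis by blast
qed

end

section \<open>Pointwise null sequences of finitely supported measures\<close>

locale null_measures = finitely_supported_measures +
  assumes null: "continuous_map X euclideanreal f \<Longrightarrow> (\<lambda>n. integral_against n f) \<longlonglongrightarrow> 0"
begin

text \<open>
  A uniform boundedness principle. The measures with density \<open>w\<close> with respect to \<open>\<mu>\<^sub>n\<close> form a null
  sequence too, and if their total variations were unbounded, \<open>norming_series\<close> along a subsequence
  on which these grow faster than \<open>3\<^sup>k\<close> would give a function whose integrals are unbounded.
\<close>

lemma weighted_variation_bounded:
  assumes w: "continuous_map X euclideanreal w"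
  obtains C where "\<And>n. (\<Sum>x\<in>F n. \<bar>\<mu> n x\<bar> * \<bar>w x\<bar>) \<le> C"
proof -
  interpret w: finitely_supported_measures X F "\<lambda>n x. \<mu> n x * w x"
    by unfold_locales (use Tychonoff finite_support support_subset in auto)
  have V: "w.total_variation n = (\<Sum>x\<in>F n. \<bar>\<mu> n x\<bar> * \<bar>w x\<bar>)" for n
    by (simp add: w.variation_def abs_mult)
  have "\<exists>C. \<forall>n. w.total_variation n \<le> C"
  proof (rule ccontr)
    assume "\<nexists>C. \<forall>n. w.total_variation n \<le> C"
    then have "\<exists>n. real k * 3 ^ k < w.total_variation n" for k
      by (meson not_le)
    then obtain p where p: "\<And>k. real k * 3 ^ k < w.total_variation (p k)" by metis
    obtain f where f: "continuous_map X euclideanreal f"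
      "\<And>k. (1/3) ^ k * w.total_variation (p k) \<le> 2 * \<bar>w.integral_against (p k) f\<bar>"
      using w.norming_series by blast
    have "w.integral_against n f = integral_against n (\<lambda>x. w x * f x)" for n
      by (simp add: w.integral_against_def integral_against_def mult.assoc)
    moreover have "(\<lambda>n. integral_against n (\<lambda>x. w x * f x)) \<longlonglongrightarrow> 0"
      by (intro null continuous_map_real_mult w f)
    ultimately have "(\<lambda>n. w.integral_against n f) \<in> c0" by (simp add: c0_def)
    then obtain B where B: "\<And>n. \<bar>w.integral_against n f\<bar> \<le> B" by (rule c0_bounded) blast
    have "real k \<le> 2 * B" for k
    proof -
      have "real k = (1/3) ^ k * (real k * 3 ^ k)" by (simp add: power_one_over)
      also have "\<dots> \<le> (1/3) ^ k * w.total_variation (p k)"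
        using p[of k] by (intro mult_left_mono) auto
      finally show ?thesis using f(2)[of k] B[of "p k"] by simp
    qed
    then show False using reals_Archimedean2[of "2 * B"] by (meson not_le)
  qed
  with that show thesis unfolding V by blast
qed

text \<open>
  For bounded \<open>f\<close> the integral is at most a multiple of the total variation itself. The weight
  \<open>f\<^sup>2\<close> in \<open>weighted_variation_bounded\<close> and the Cauchy-Schwarz inequality give a bound that still
  tends to zero with the total variation when \<open>f\<close> is unbounded on the supports.
\<close>

lemma integral_against_small:
  assumes f: "continuous_map X euclideanreal f"
  obtains C where "\<And>n. \<bar>integral_against n f\<bar> \<le> C * sqrt (total_variation n)"
proof -
  obtain C where C: "\<And>n. (\<Sum>x\<in>F n. \<bar>\<mu> n x\<bar> * \<bar>f x * f x\<bar>) \<le> C"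
    using weighted_variation_bounded[OF continuous_map_real_mult[OF f f]] by blast
  have "\<bar>integral_against n f\<bar> \<le> sqrt C * sqrt (total_variation n)" for n
  proof -
    have "\<bar>integral_against n f\<bar> \<le> (\<Sum>x\<in>F n. \<bar>sqrt \<bar>\<mu> n x\<bar> * f x\<bar> * \<bar>sqrt \<bar>\<mu> n x\<bar>\<bar>)"
      unfolding integral_against_def
      by (rule order_trans[OF sum_abs]) (auto intro!: sum_mono simp: abs_mult mult.commute mult.left_commute)
    also have "\<dots> \<le> L2_set (\<lambda>x. sqrt \<bar>\<mu> n x\<bar> * f x) (F n) * L2_set (\<lambda>x. sqrt \<bar>\<mu> n x\<bar>) (F n)"
      by (rule L2_set_mult_ineq)
    also have "\<dots> = sqrt (\<Sum>x\<in>F n. \<bar>\<mu> n x\<bar> * \<bar>f x * f x\<bar>) * sqrt (total_variation n)"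
      by (simp add: L2_set_def variation_def power_mult_distrib power2_eq_square[of "f _"])
    also have "\<dots> \<le> sqrt C * sqrt (total_variation n)"
      using C[of n] by (intro mult_right_mono) (auto simp: variation_nonneg)
    finally show ?thesis .
  qed
  with that show thesis by blast
qed

text \<open>
  Otherwise the measures are eventually concentrated, up to any given error, on a finite set. This
  is used at two scales: up to \<open>\<delta> / 4\<close> the mass lies on a finite set \<open>A\<close>, and up to an error that is
  small even after multiplication by \<open>card A\<close> it lies on a finite set \<open>B\<close>. Test functions that are
  \<open>1\<close> at one point of \<open>A\<close> and \<open>0\<close> at the other points of \<open>B\<close> show that each atom in \<open>A\<close> is
  eventually not much larger than the error for \<open>B\<close>. Hence the mass on \<open>A\<close> is small as well,
  and the total variations are eventually below \<open>\<delta>\<close>.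
\<close>

lemma escape_of_mass:
  assumes inf: "infinite {n. \<delta> \<le> total_variation n}" and \<delta>: "0 < \<delta>"
  obtains c where "0 < c" "\<And>A n. finite A \<Longrightarrow> \<exists>j\<ge>n. c \<le> variation j (- A)"
proof -
  have "\<exists>c>0. \<forall>A n. finite A \<longrightarrow> (\<exists>j\<ge>n. c \<le> variation j (- A))"
  proof (rule ccontr)
    assume "\<not> ?thesis"
    then have tight: "\<exists>A n. finite A \<and> (\<forall>j\<ge>n. variation j (- A) < c)" if "0 < c" for c
      using that by (meson not_le)
    obtain A n1 where A: "finite A" "\<And>j. j \<ge> n1 \<Longrightarrow> variation j (- A) < \<delta> / 4"
      using tight[of "\<delta> / 4"] \<delta> by auto
    define c where "c = \<delta> / (8 * (card A + 1))"
    have c: "0 < c" "card A * c \<le> \<delta> / 8"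
      using \<delta> by (auto simp: c_def field_simps)
    obtain B n2 where B: "finite B" "\<And>j. j \<ge> n2 \<Longrightarrow> variation j (- B) < c"
      using tight[OF c(1)] by auto
    have "\<exists>u. continuous_map X euclideanreal u \<and> (\<forall>y\<in>topspace X. \<bar>u y\<bar> \<le> 1) \<and> u x = 1 \<and>
        (\<forall>y\<in>B \<inter> topspace X - {x}. u y = 0)" if "x \<in> topspace X" for x
      using Tychonoff_separate_point[OF Tychonoff, of "B \<inter> topspace X" x] B(1) that
      by (metis finite_Int inf_le2)
    then obtain u where u: "\<And>x. x \<in> topspace X \<Longrightarrow> continuous_map X euclideanreal (u x)"
        "\<And>x y. x \<in> topspace X \<Longrightarrow> y \<in> topspace X \<Longrightarrow> \<bar>u x y\<bar> \<le> 1"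
        "\<And>x. x \<in> topspace X \<Longrightarrow> u x x = 1"
        "\<And>x y. x \<in> topspace X \<Longrightarrow> y \<in> B \<inter> topspace X - {x} \<Longrightarrow> u x y = 0"
      by metis
    define A' where "A' = A \<inter> topspace X"
    have A': "finite A'" using A(1) by (simp add: A'_def)
    have atom: "\<bar>\<mu> j x\<bar> \<le> \<bar>integral_against j (u x)\<bar> + variation j (- B)" if x: "x \<in> F j" for j x
    proof -
      have xX: "x \<in> topspace X" using x support_subset by blast
      have "integral_against j (u x) = \<mu> j x + (\<Sum>y\<in>F j - {x}. \<mu> j y * u x y)"
        unfolding integral_against_def using x by (simp add: sum.remove[OF finite_support x] u(3)[OF xX])
      moreover have "\<bar>\<Sum>y\<in>F j - {x}. \<mu> j y * u x y\<bar> \<le> variation j (- B)"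
      proof -
        have "(\<Sum>y\<in>F j - {x}. \<mu> j y * u x y) = (\<Sum>y\<in>F j - {x} - B. \<mu> j y * u x y)"
          by (rule sum.mono_neutral_right) (use finite_support support_subset u(4)[OF xX] in auto)
        also have "\<bar>\<dots>\<bar> \<le> (\<Sum>y\<in>F j - {x} - B. \<bar>\<mu> j y * u x y\<bar>)" by (rule sum_abs)
        also have "\<dots> \<le> (\<Sum>y\<in>F j - {x} - B. \<bar>\<mu> j y\<bar>)"
        proof (rule sum_mono)
          fix y assume "y \<in> F j - {x} - B"
          then have "\<bar>u x y\<bar> \<le> 1" using u(2)[OF xX] support_subset by blast
          then show "\<bar>\<mu> j y * u x y\<bar> \<le> \<bar>\<mu> j y\<bar>" by (simp add: abs_mult mult_left_le)
        qed
        also have "\<dots> \<le> variation j (- B)"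
          unfolding variation_def by (rule sum_mono2) (use finite_support in auto)
        finally show ?thesis .
      qed
      ultimately show ?thesis by linarith
    qed
    have bound: "variation j A \<le> (\<Sum>x\<in>A'. \<bar>integral_against j (u x)\<bar>) + card A * variation j (- B)" for j
    proof -
      have "variation j A \<le> (\<Sum>x\<in>F j \<inter> A. \<bar>integral_against j (u x)\<bar> + variation j (- B))"
        unfolding variation_def[of j A] by (rule sum_mono) (use atom in auto)
      also have "\<dots> \<le> (\<Sum>x\<in>A'. \<bar>integral_against j (u x)\<bar> + variation j (- B))"
        by (rule sum_mono2) (use A' support_subset variation_nonneg in \<open>auto simp: A'_def\<close>)
      also have "\<dots> = (\<Sum>x\<in>A'. \<bar>integral_against j (u x)\<bar>) + card A' * variation j (- B)"
        by (simp add: sum.distrib)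
      also have "\<dots> \<le> (\<Sum>x\<in>A'. \<bar>integral_against j (u x)\<bar>) + card A * variation j (- B)"
        using A(1) by (intro add_left_mono mult_right_mono variation_nonneg) (auto simp: A'_def intro: card_mono)
      finally show ?thesis .
    qed
    have "(\<lambda>j. \<Sum>x\<in>A'. \<bar>integral_against j (u x)\<bar>) \<longlonglongrightarrow> (\<Sum>x\<in>A'. \<bar>0\<bar>)"
      by (intro tendsto_sum tendsto_rabs null u) (simp add: A'_def)
    then have "\<forall>\<^sub>F j in sequentially. (\<Sum>x\<in>A'. \<bar>integral_against j (u x)\<bar>) < \<delta> / 4"
      using \<delta> by (intro order_tendstoD(2)) auto
    then obtain n3 where n3: "\<And>j. j \<ge> n3 \<Longrightarrow> (\<Sum>x\<in>A'. \<bar>integral_against j (u x)\<bar>) < \<delta> / 4"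
      by (auto simp: eventually_sequentially)
    have "total_variation j < \<delta>" if j: "j \<ge> n1 + n2 + n3" for j
    proof -
      have "card A * variation j (- B) \<le> card A * c"
        using B(2)[of j] j by (intro mult_left_mono) auto
      then show ?thesis
        using variation_split[of j A] A(2)[of j] bound[of j] n3[of j] c(2) \<delta> j by linarith
    qed
    then have "{n. \<delta> \<le> total_variation n} \<subseteq> {..<n1 + n2 + n3}"
      by (auto simp: not_le[symmetric])
    with inf show False by (meson finite_lessThan finite_subset)
  qed
  with that show thesis by blast
qed

text \<open>
  The function is built on finite sets, one measure at a time. Outside the finite set \<open>A\<close> used
  so far, some later measure \<open>\<mu>\<^sub>i\<close> has mass at least \<open>c\<close>. Giving the new points the signs of
  \<open>\<mu>\<^sub>i\<close>, or all the opposite signs, adds this mass to or subtracts it from the contribution of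
  \<open>A\<close>, and one of the two results is at least \<open>c\<close> in modulus. The integrals already treated do not
  change, because those measures live on \<open>A\<close>. Continuity is obtained by interpolation at the end.
\<close>

lemma many_large_integrals:
  assumes inf: "infinite {n. \<delta> \<le> total_variation n}" and \<delta>: "0 < \<delta>"
  obtains c where "0 < c"
    "\<And>N. \<exists>h J. continuous_map X euclideanreal h \<and> (\<forall>x\<in>topspace X. \<bar>h x\<bar> \<le> 1) \<and>
       finite J \<and> card J = N \<and> (\<forall>j\<in>J. c \<le> \<bar>integral_against j h\<bar>)"
proof -
  obtain c where c: "0 < c" "\<And>A n. finite A \<Longrightarrow> \<exists>j\<ge>n. c \<le> variation j (- A)"
    using escape_of_mass[OF assms] by blast
  have signs: "\<exists>A s J. finite A \<and> A \<subseteq> topspace X \<and> (\<forall>x. \<bar>s x\<bar> \<le> 1) \<and> finite J \<and> card J = N \<and>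
      (\<forall>j\<in>J. F j \<subseteq> A \<and> c \<le> \<bar>integral_against j s\<bar>)" for N
  proof (induction N)
    case 0
    show ?case by (intro exI[of _ "{}"] exI[of _ "\<lambda>x. 0"]) auto
  next
    case (Suc N)
    then obtain A s J where IH: "finite A" "A \<subseteq> topspace X" "\<And>x. \<bar>s x\<bar> \<le> 1" "finite J" "card J = N"
        "\<And>j. j \<in> J \<Longrightarrow> F j \<subseteq> A" "\<And>j. j \<in> J \<Longrightarrow> c \<le> \<bar>integral_against j s\<bar>" by blast
    obtain n where n: "\<And>j. j \<in> J \<Longrightarrow> j < n"
      using IH(4) by (auto simp: finite_nat_set_iff_bounded)
    obtain i where i: "i \<ge> n" "c \<le> variation i (- A)" using c(2)[OF IH(1)] by blast
    define s' where "s' \<sigma> x = (if x \<in> A then s x else \<sigma> * sgn (\<mu> i x))" for \<sigma> x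
    let ?a = "\<Sum>x\<in>F i \<inter> A. \<mu> i x * s x"
    have "integral_against i (s' \<sigma>) = ?a + \<sigma> * variation i (- A)" for \<sigma>
    proof -
      have "integral_against i (s' \<sigma>) =
          (\<Sum>x\<in>F i \<inter> A. \<mu> i x * s' \<sigma> x) + (\<Sum>x\<in>F i \<inter> - A. \<mu> i x * s' \<sigma> x)"
        unfolding integral_against_def
        by (subst sum.union_disjoint[symmetric]) (auto simp: finite_support intro!: sum.cong)
      also have "(\<Sum>x\<in>F i \<inter> A. \<mu> i x * s' \<sigma> x) = ?a"
        by (rule sum.cong) (auto simp: s'_def)
      also have "(\<Sum>x\<in>F i \<inter> - A. \<mu> i x * s' \<sigma> x) = \<sigma> * variation i (- A)"
        unfolding variation_def sum_distrib_left
        by (rule sum.cong) (auto simp: s'_def abs_sgn)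
      finally show ?thesis .
    qed
    then obtain \<sigma> :: real where \<sigma>: "\<bar>\<sigma>\<bar> = 1" "c \<le> \<bar>integral_against i (s' \<sigma>)\<bar>"
      using that[of 1] i(2) by (cases "0 \<le> ?a") (fastforce dest: spec[of _ 1] spec[of _ "-1"])+
    have "integral_against j (s' \<sigma>) = integral_against j s" if "j \<in> J" for j
      unfolding integral_against_def using IH(6)[OF that] by (intro sum.cong) (auto simp: s'_def)
    then have "\<forall>j\<in>insert i J. F j \<subseteq> A \<union> F i \<and> c \<le> \<bar>integral_against j (s' \<sigma>)\<bar>"
      using IH(6,7) \<sigma>(2) by auto
    moreover have "card (insert i J) = Suc N" using IH(4,5) n[of i] i(1) by (auto simp: card_insert_if)
    moreover have "\<bar>s' \<sigma> x\<bar> \<le> 1" for x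
      using IH(3) \<sigma>(1) by (auto simp: s'_def abs_mult abs_sgn_eq)
    ultimately show ?case
      using IH(1,2,4) finite_support[of i] support_subset[of i]
      by (intro exI[of _ "A \<union> F i"] exI[of _ "s' \<sigma>"] exI[of _ "insert i J"]) auto
  qed
  have "\<exists>h J. continuous_map X euclideanreal h \<and> (\<forall>x\<in>topspace X. \<bar>h x\<bar> \<le> 1) \<and>
       finite J \<and> card J = N \<and> (\<forall>j\<in>J. c \<le> \<bar>integral_against j h\<bar>)" for N
  proof -
    obtain A s J where S: "finite A" "A \<subseteq> topspace X" "\<And>x. \<bar>s x\<bar> \<le> 1" "finite J" "card J = N"
        "\<And>j. j \<in> J \<Longrightarrow> F j \<subseteq> A" "\<And>j. j \<in> J \<Longrightarrow> c \<le> \<bar>integral_against j s\<bar>"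
      using signs[of N] by blast
    obtain h where h: "continuous_map X euclideanreal h" "\<And>x. x \<in> topspace X \<Longrightarrow> \<bar>h x\<bar> \<le> 1"
        "\<And>x. x \<in> A \<Longrightarrow> h x = s x"
      using Tychonoff_interpolation[OF Tychonoff S(1,2), of s] S(3) by blast
    have "integral_against j h = integral_against j s" if "j \<in> J" for j
      unfolding integral_against_def using S(6)[OF that] h(3) by (intro sum.cong) auto
    with h(1,2) S(4,5,7) show ?thesis by (intro exI[of _ h] exI[of _ J]) auto
  qed
  with c(1) that show thesis by blast
qed

text \<open>
  The constants \<open>a\<close> and \<open>q\<close> are chosen before the counts \<open>N\<close>; this is what lets the counts be
  adapted to an arbitrary null sequence later. The blocks have size \<open>2 N\<^sub>k\<close> because the
  series preserves only half of each block.
\<close>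

lemma prescribed_level_counts:
  assumes inf: "infinite {n. \<delta> \<le> total_variation n}" and \<delta>: "0 < \<delta>"
  obtains a q where "0 < a" "0 < q" "q < 1"
    "\<And>N :: nat \<Rightarrow> nat. \<exists>f. continuous_map X euclideanreal f \<and>
       (\<forall>k. N k \<le> card {j. a * q ^ k \<le> \<bar>integral_against j f\<bar>})"
proof -
  obtain c where c: "0 < c"
    "\<And>N. \<exists>h J. continuous_map X euclideanreal h \<and> (\<forall>x\<in>topspace X. \<bar>h x\<bar> \<le> 1) \<and>
       finite J \<and> card J = N \<and> (\<forall>j\<in>J. c \<le> \<bar>integral_against j h\<bar>)"
    using many_large_integrals[OF assms] by blast
  obtain C where C: "\<And>n. (\<Sum>x\<in>F n. \<bar>\<mu> n x\<bar> * \<bar>1\<bar>) \<le> C"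
    using weighted_variation_bounded[of "\<lambda>x. 1"] by auto
  define M where "M = max C 1"
  have M: "0 < M" "\<And>n. total_variation n \<le> M"
    using C by (auto simp: M_def variation_def le_max_iff_disj)
  define b where "b = c / M"
  have b: "0 < b" using c M by (simp add: b_def)
  define q where "q = b / (b + 2)"
  have q: "0 < q" "q < 1" using b by (auto simp: q_def)
  define a where "a = b / 2 * c"
  have a: "0 < a" using b c by (simp add: a_def)
  have "\<exists>f. continuous_map X euclideanreal f \<and>
      (\<forall>k. N k \<le> card {j. a * q ^ k \<le> \<bar>integral_against j f\<bar>})" for N :: "nat \<Rightarrow> nat"
  proof -
    have "\<exists>h J. continuous_map X euclideanreal h \<and> (\<forall>x\<in>topspace X. \<bar>h x\<bar> \<le> 1) \<and>
       finite J \<and> card J = 2 * N k \<and> (\<forall>j\<in>J. c \<le> \<bar>integral_against j h\<bar>)" for k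
      by (rule c(2))
    then obtain h J where h: "\<And>k. continuous_map X euclideanreal (h k)"
        "\<And>k x. x \<in> topspace X \<Longrightarrow> \<bar>h k x\<bar> \<le> 1"
      and J: "\<And>k. finite (J k)" "\<And>k. card (J k) = 2 * N k"
        "\<And>k j. j \<in> J k \<Longrightarrow> c \<le> \<bar>integral_against j (h k)\<bar>"
      by metis
    have bJ: "b * total_variation j \<le> \<bar>integral_against j (h k)\<bar>" if "j \<in> J k" for j k
    proof -
      have "b * total_variation j \<le> b * M" using b M(2) by (intro mult_left_mono) auto
      also have "\<dots> = c" using M(1) by (simp add: b_def)
      finally show ?thesis using J(3)[OF that] by linarith
    qed
    \<comment> \<open>Functions bounded by \<open>1\<close> have large integrals only against measures of large total variation.\<close>
    have cJ: "c \<le> total_variation j" if "j \<in> J k" for j k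
      using J(3)[OF that] integral_against_bound[of "h k" 1 j] h(2) by auto
    obtain f where f: "continuous_map X euclideanreal f"
      "\<And>k. card (J k) \<le>
         2 * card {j \<in> J k. b / 2 * (b / (b + 2)) ^ k * total_variation j \<le> \<bar>integral_against j f\<bar>}"
      using signed_geometric_series[of h b J, OF h b J(1) bJ] by blast
    have fc: "(\<lambda>j. integral_against j f) \<in> c0" using null[OF f(1)] by (simp add: c0_def)
    have "N k \<le> card {j. a * q ^ k \<le> \<bar>integral_against j f\<bar>}" for k
    proof -
      have "a * q ^ k \<le> b / 2 * q ^ k * total_variation j" if "j \<in> J k" for j
        using mult_left_mono[OF cJ[OF that], of "b / 2 * q ^ k"] b q by (simp add: a_def mult_ac)
      then have "{j \<in> J k. b / 2 * q ^ k * total_variation j \<le> \<bar>integral_against j f\<bar>} \<subseteq>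
          {j. a * q ^ k \<le> \<bar>integral_against j f\<bar>}"
        using order_trans by blast
      then have "card {j \<in> J k. b / 2 * q ^ k * total_variation j \<le> \<bar>integral_against j f\<bar>} \<le>
          card {j. a * q ^ k \<le> \<bar>integral_against j f\<bar>}"
        by (intro card_mono c0_finite_superlevel[OF fc]) (use a q in auto)
      with f(2)[of k] J(2)[of k] show ?thesis by (simp add: q_def)
    qed
    with f(1) show ?thesis by blast
  qed
  with a q that show thesis by blast
qed

section \<open>The range is a symmetric sequence ideal\<close>

text \<open>
  If the total variations tended to zero, they would be much smaller on a sparse sequence of
  positions than the squares of the coordinates of an element of \<open>E\<close> with no zero coordinate.
  Symmetry moves these coordinates to the sparse positions, and \<open>integral_against_small\<close> forbids
  the resulting element of \<open>E\<close> to be in the range.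
\<close>

lemma infinitely_many_large_variations:
  assumes E: "symmetric_sequence_ideal E" "E \<noteq> {\<lambda>n. 0}"
    and range: "E = (\<lambda>f n. integral_against n f) ` {f. continuous_map X euclideanreal f}"
  obtains \<delta> where "0 < \<delta>" "infinite {n. \<delta> \<le> total_variation n}"
proof -
  have "\<exists>\<delta>>0. infinite {n. \<delta> \<le> total_variation n}"
  proof (rule ccontr)
    assume "\<not> ?thesis"
    then have fin: "finite {n. \<delta> \<le> total_variation n}" if "0 < \<delta>" for \<delta>
      using that by blast
    obtain a where a: "a \<noteq> 0" "\<And>n. (\<lambda>k. if k = n then a else 0) \<in> E"
      using symmetric_sequence_ideal_unit[OF E] by blast
    \<comment> \<open>No measure is zero, since \<open>E\<close> contains multiples of the unit vectors.\<close>
    have pos: "0 < total_variation n" for n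
    proof -
      obtain f where "(\<lambda>k. if k = n then a else 0) = (\<lambda>k. integral_against k f)"
          "continuous_map X euclideanreal f"
        using a(2)[of n] unfolding range by blast
      moreover from this obtain C where "\<bar>integral_against n f\<bar> \<le> C * sqrt (total_variation n)"
        using integral_against_small by blast
      moreover have "integral_against n f = a" using calculation(1) by metis
      ultimately have "total_variation n \<noteq> 0" using a(1) by auto
      then show ?thesis using variation_nonneg[of n UNIV] by simp
    qed
    obtain f where f: "continuous_map X euclideanreal f"
        "\<And>k. (1/3) ^ k * total_variation k \<le> 2 * \<bar>integral_against k f\<bar>"
      using norming_series[of "\<lambda>k. k"] by blast
    define x where "x k = integral_against k f" for k
    have xE: "x \<in> E" unfolding range x_def using f(1) by blast
    have xpos: "0 < \<bar>x k\<bar>" for k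
    proof -
      have "0 < (1/3::real) ^ k * total_variation k" using pos[of k] by simp
      with f(2)[of k] show ?thesis unfolding x_def by linarith
    qed
    \<comment> \<open>The factor \<open>k + 1\<close> defeats the unknown constant in \<open>integral_against_small\<close>.\<close>
    define e where "e k = (\<bar>x k\<bar> / (real k + 1))\<^sup>2" for k
    have e: "0 < e k" for k using xpos[of k] by (simp add: e_def)
    have next_index: "\<exists>m>n. total_variation m \<le> e k" for k n
    proof -
      have "finite ({m. e k \<le> total_variation m} \<union> {..n})" using fin[OF e] by simp
      then obtain m where "m \<notin> {m. e k \<le> total_variation m} \<union> {..n}"
        using ex_new_if_finite[OF infinite_UNIV_nat] by blast
      then show ?thesis by (intro exI[of _ m]) auto
    qed
    have "\<exists>p. \<forall>k. total_variation (p k) \<le> e k \<and> p k < p (Suc k)"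
      by (rule dependent_nat_choice) (use next_index in blast)+
    then obtain p where p: "\<And>k. total_variation (p k) \<le> e k" "\<And>k. p k < p (Suc k)" by blast
    have "strict_mono p" using p(2) by (simp add: strict_mono_Suc_iff)
    then obtain y where y: "y \<in> E" "\<And>k. y (p k) = x k"
      using symmetric_sequence_ideal_relocate[OF E(1) xE] by blast
    then obtain g where g: "continuous_map X euclideanreal g" "y = (\<lambda>n. integral_against n g)"
      unfolding range by blast
    obtain C where C: "\<And>n. \<bar>integral_against n g\<bar> \<le> C * sqrt (total_variation n)"
      using integral_against_small[OF g(1)] by blast
    have "real k + 1 \<le> \<bar>C\<bar>" for k
    proof -
      have "\<bar>x k\<bar> = \<bar>integral_against (p k) g\<bar>" using y(2)[of k] g(2) by simp
      also have "\<dots> \<le> C * sqrt (total_variation (p k))" by (rule C)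
      also have "\<dots> \<le> \<bar>C\<bar> * sqrt (e k)"
        using p(1)[of k] by (intro mult_mono) (auto simp: variation_nonneg)
      also have "sqrt (e k) = \<bar>x k\<bar> / (real k + 1)" by (simp add: e_def)
      finally have "\<bar>x k\<bar> * (real k + 1) \<le> \<bar>x k\<bar> * \<bar>C\<bar>" by (simp add: field_simps)
      then show ?thesis using xpos[of k] by simp
    qed
    then show False using reals_Archimedean2[of "\<bar>C\<bar>"] by (smt (verit))
  qed
  with that show thesis by blast
qed

text \<open>
  A null sequence is scaled so that it is bounded by \<open>a\<close>, and \<open>f\<close> is chosen so that above level
  \<open>a q\<^sup>k\<close> there are at least as many integrals as the sequence has terms above the next level
  \<open>a q\<^sup>k\<^sup>+\<^sup>1\<close>. This shift by one makes the comparison valid at every intermediate level \<open>t\<close>.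
\<close>

lemma range_ideal_eq_c0:
  assumes E: "symmetric_sequence_ideal E" "E \<noteq> {\<lambda>n. 0}"
    and range: "E = (\<lambda>f n. integral_against n f) ` {f. continuous_map X euclideanreal f}"
  shows "E = c0"
proof
  show "E \<subseteq> c0" using E(1) by (simp add: symmetric_sequence_ideal_def)
  obtain \<delta> where "0 < \<delta>" "infinite {n. \<delta> \<le> total_variation n}"
    using infinitely_many_large_variations[OF assms] .
  then obtain a q where a: "0 < a" and q: "0 < q" "q < 1" and
    levels: "\<And>N :: nat \<Rightarrow> nat. \<exists>f. continuous_map X euclideanreal f \<and>
       (\<forall>k. N k \<le> card {j. a * q ^ k \<le> \<bar>integral_against j f\<bar>})"
    using prescribed_level_counts[of \<delta>] by blast
  show "c0 \<subseteq> E"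
  proof
    fix y assume "y \<in> c0"
    then obtain B where B: "0 < B" "\<And>j. \<bar>y j\<bar> \<le> B" using c0_bounded by blast
    define z where "z = (\<lambda>j. a / B * y j)"
    have zc: "z \<in> c0"
      using \<open>y \<in> c0\<close> unfolding c0_def z_def mem_Collect_eq by (rule tendsto_mult_right_zero)
    have za: "\<bar>z j\<bar> \<le> a" for j
      using B(1) B(2)[of j] a by (simp add: z_def abs_mult field_simps)
    obtain f where f: "continuous_map X euclideanreal f"
        "\<And>k. card {j. a * q ^ Suc k \<le> \<bar>z j\<bar>} \<le> card {j. a * q ^ k \<le> \<bar>integral_against j f\<bar>}"
      using levels[of "\<lambda>k. card {j. a * q ^ Suc k \<le> \<bar>z j\<bar>}"] by blast
    have fE: "(\<lambda>j. integral_against j f) \<in> E" unfolding range using f(1) by blast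
    have fc: "(\<lambda>j. integral_against j f) \<in> c0" using null[OF f(1)] by (simp add: c0_def)
    have "z \<in> E"
    proof (rule symmetric_sequence_ideal_card[OF E(1) fE zc])
      fix t :: real assume t: "0 < t"
      show "card {j. t \<le> \<bar>z j\<bar>} \<le> card {j. t \<le> \<bar>integral_against j f\<bar>}"
      proof (cases "t \<le> a")
        case False
        then have "{j. t \<le> \<bar>z j\<bar>} = {}" using za by (auto simp: not_le intro: le_less_trans)
        then show ?thesis by (simp only: card.empty)
      next
        case True
        obtain n where "q ^ n < t / a" using real_arch_pow_inv[of "t / a" q] q t a by auto
        then have "a * q ^ n < t" using a by (simp add: field_simps)
        moreover have "\<not> a * q ^ 0 < t" using True by simp
        ultimately obtain k where k: "\<not> a * q ^ k < t" "a * q ^ Suc k < t"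
          using ex_least_nat_less[of "\<lambda>n. a * q ^ n < t" n] by blast
        have "card {j. t \<le> \<bar>z j\<bar>} \<le> card {j. a * q ^ Suc k \<le> \<bar>z j\<bar>}"
          by (intro card_mono c0_finite_superlevel[OF zc]) (use a q k in auto)
        also note f(2)
        also have "card {j. a * q ^ k \<le> \<bar>integral_against j f\<bar>} \<le> card {j. t \<le> \<bar>integral_against j f\<bar>}"
          by (intro card_mono c0_finite_superlevel[OF fc t]) (use k in auto)
        finally show ?thesis .
      qed
    qed
    then have "(\<lambda>j. B / a * z j) \<in> E"
      using E(1) seq.subspace_scale[of E z "B / a"] by (simp add: symmetric_sequence_ideal_def)
    moreover have "(\<lambda>j. B / a * z j) = y" using a B(1) by (simp add: z_def)
    ultimately show "y \<in> E" by simp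
  qed
qed

end

theorem theorem1p1:
  fixes X :: "'a topology" and E :: "(nat \<Rightarrow> real) set"
  assumes "Tychonoff_space X"
    and "symmetric_sequence_ideal E"
    and "E \<noteq> {\<lambda>n. 0}"
    and "\<exists>T. continuous_linear_surjection X E T"
  shows "E = c0"
proof -
  obtain T where T: "continuous_map (Cp X) (pointwise_topology E) T" "linear_on_Cp X T"
      "T ` topspace (Cp X) = E"
    using assms(4) by (auto simp: continuous_linear_surjection_def)
  have "\<exists>F \<mu>. finite F \<and> F \<subseteq> topspace X \<and> (\<forall>f. continuous_map X euclideanreal f \<longrightarrow>
      T (restrict f (topspace X)) n = (\<Sum>x\<in>F. \<mu> x * f x))" for n
  proof -
    have "continuous_map (pointwise_topology E) euclideanreal (\<lambda>x. x n)"
      unfolding pointwise_topology_def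
      by (intro continuous_map_from_subtopology continuous_map_product_projection) simp
    then have "continuous_map (Cp X) euclideanreal (\<lambda>f. T f n)"
      using continuous_map_compose[OF T(1)] by (simp add: comp_def)
    then show ?thesis
    proof (rule Cp_functional_finite_support[OF assms(1)])
      show "T (\<lambda>x\<in>topspace X. f x + g x) n = T f n + T g n"
        if "f \<in> topspace (Cp X)" "g \<in> topspace (Cp X)" for f g
        using T(2) that unfolding linear_on_Cp_def by simp
      show "T (\<lambda>x\<in>topspace X. c * f x) n = c * T f n" if "f \<in> topspace (Cp X)" for c f
        using T(2) that unfolding linear_on_Cp_def by simp
    qed blast
  qed
  then obtain F \<mu> where F: "\<And>n. finite (F n)" "\<And>n. F n \<subseteq> topspace X"
      "\<And>n f. continuous_map X euclideanreal f \<Longrightarrow>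
         T (restrict f (topspace X)) n = (\<Sum>x\<in>F n. \<mu> n x * f x)"
    by metis
  interpret finitely_supported_measures X F \<mu>
    using assms(1) F(1,2) by unfold_locales
  have TI: "T (restrict f (topspace X)) = (\<lambda>n. integral_against n f)"
    if "continuous_map X euclideanreal f" for f
    using F(3)[OF that] by (auto simp: integral_against_def)
  have "topspace (Cp X) = (\<lambda>f. restrict f (topspace X)) ` {f. continuous_map X euclideanreal f}"
    by (auto simp: Cp_topspace restrict_in_Cp[unfolded Cp_topspace] extensional_restrict
        intro!: image_eqI[where f = "\<lambda>f. restrict f (topspace X)"])
  then have range: "E = (\<lambda>f n. integral_against n f) ` {f. continuous_map X euclideanreal f}"
    unfolding T(3)[symmetric] by (auto simp: image_image TI)
  interpret null_measures X F \<mu>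
  proof
    fix f assume "continuous_map X euclideanreal f"
    then have "(\<lambda>n. integral_against n f) \<in> E" unfolding range by blast
    then show "(\<lambda>n. integral_against n f) \<longlonglongrightarrow> 0"
      using assms(2) by (auto simp: symmetric_sequence_ideal_def c0_def)
  qed
  show ?thesis by (rule range_ideal_eq_c0[OF assms(2,3) range])
qed

end
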